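(* In the missing-data setting described in the context, assume that $\{\widehat{\beta}_n\}$ is strongly consistent for $\beta_0$, i.e. $\widehat\beta_n\to\beta_0$ a.s. Then: (a) $\{\widehat F_n\}$ converges weakly to $F_0$ a.s., i.e. $\mathrm{P}(\widehat F_n\rightarrow_w F_0)=1$. (b) Assume also that the location functional $T_L$ is weakly continuous at $F_0$; then $\widehat\mu_n=T_L(\widehat F_n)$ converges a.s. to $\mu_0=T_L(F_0)$.
   Context: Setting. $(\mathbf{x}_i,y_i,a_i)$, $i\ge 1$, are i.i.d., with $\mathbf{x}_i\in\mathbb{R}^p$, $y_i\in\mathbb{R}$, $a_i\in\{0,1\}$; $\mathbf{x}_i$ is always observed and $y_i$ is observed iff $a_i=1$. The model is $y_i=g(\mathbf{x}_i,\beta_0)+u_i$, where $g:\mathbb{R}^p\times B\to\mathbb{R}$ is known, $\beta_0\in B\subset\mathbb{R}^q$, and $u_i$ is independent of $(\mathbf{x}_i,a_i)$. Let $\eta=\mathrm{E}a_i>0$. $Q_0$, $K_0$, $F_0$ are the distributions of $\mathbf{x}_i$, $u_i$, $y_i$. Identification: $\mathrm{P}_{Q_0}(g(\mathbf{x},\beta_0)=g(\mathbf{x},\beta)+\alpha)<1$ for all $\beta\ne\beta_0$ and all $\alpha\in\mathbb{R}$. Standing regularity of $g$: $g(\mathbf{x},\beta)$ is twice continuously differentiable in $\beta$ with gradient $\dot g$ and Hessian $\ddot g$ (with respect to $\beta$), and for some $\delta>0$, $\mathrm{E}_{Q_0}\sup_{\|\beta-\beta_0\|\le\delta}\|\dot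 g(\mathbf{x}_1,\beta)\|^2<\infty$ and $\mathrm{E}_{Q_0}\sup_{\|\beta-\beta_0\|\le\delta}\|\ddot g(\mathbf{x}_1,\beta)\|<\infty$. Estimates. $\widehat\beta_n$ is an estimator of $\beta_0$ based on the observations $(\mathbf{x}_i,y_i)$, $1\le i\le n$, with $a_i=1$. Let $A=\{i\le n:a_i=1\}$, $m=\#A$, $\widehat u_i=y_i-g(\mathbf{x}_i,\widehat\beta_n)$ for $i\in A$, $\widehat y_{ij}=g(\mathbf{x}_j,\widehat\beta_n)+\widehat u_i$ for $i\in A$, $1\le j\le n$, and $$\widehat F_n=\frac1{nm}\sum_{i\in A}\sum_{j=1}^n\delta_{\widehat y_{ij}},$$ where $\delta_s$ is the point mass at $s$. A location functional $T_L$, defined on a class of univariate distribution functions, assigns to each $F$ in the class a real number $T_L(F)$ with $T_L(F_{ay+b})=aT_L(F_y)+b$, where $F_y$ is the distribution of $y$. $T_L$ is weakly continuous at $F$ if $F_n\rightarrow_w F$ implies $T_L(F_n)\to T_L(F)$. $\rightarrow_w$ denotes weak convergence of distributions. *)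

theory Defs
  imports "HOL-Probability.Probability"
begin

text \<open>
  Observations are indexed from \<open>0\<close>, so that the first \<open>n\<close> of them are those with \<open>i < n\<close>.
  The regression function \<open>g\<close> is total in HOL, but is constrained and evaluated only for
  parameters in \<open>B\<close>.  Derivatives in the parameter are taken within \<open>B\<close>, and suprema range over the
  part of the closed \<open>\<delta>\<close>-ball lying in \<open>B\<close>; if the ball is contained in the interior of \<open>B\<close>, these
  are the ordinary gradient, Hessian and supremum over the ball.  Independence of \<open>u\<^sub>i\<close> and
  \<open>(x\<^sub>i, a\<^sub>i)\<close> is stated through the generated \<open>\<sigma>\<close>-algebras, since \<open>indep_var\<close> needs both
  variables to have the same type.  Integrals of suprema are taken in
  \<open>[0, \<infinity>]\<close>, so no boundedness is presupposed.
\<close>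

locale missing_data_model = prob_space M
  for M :: "'w measure" +
  fixes x :: "nat \<Rightarrow> 'w \<Rightarrow> real ^ 'p"
    and y a u :: "nat \<Rightarrow> 'w \<Rightarrow> real"
    and g :: "real ^ 'p \<Rightarrow> real ^ 'q \<Rightarrow> real"
    and gdot :: "real ^ 'p \<Rightarrow> real ^ 'q \<Rightarrow> real ^ 'q"
    and gddot :: "real ^ 'p \<Rightarrow> real ^ 'q \<Rightarrow> real ^ 'q ^ 'q"
    and B :: "(real ^ 'q) set"
    and \<beta>\<^sub>0 :: "real ^ 'q"
  assumes indep: "indep_vars (\<lambda>_. borel) (\<lambda>i \<omega>. (x i \<omega>, y i \<omega>, a i \<omega>)) UNIV"
    and ident_distr: "distr M borel (\<lambda>\<omega>. (x i \<omega>, y i \<omega>, a i \<omega>)) =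
                      distr M borel (\<lambda>\<omega>. (x 0 \<omega>, y 0 \<omega>, a 0 \<omega>))"
    and a_01: "\<omega> \<in> space M \<Longrightarrow> a i \<omega> \<in> {0, 1}"
    and eta_pos: "expectation (a 0) > 0"
    and \<beta>\<^sub>0_in: "\<beta>\<^sub>0 \<in> B"
    and g_measurable: "\<beta> \<in> B \<Longrightarrow> (\<lambda>v. g v \<beta>) \<in> borel_measurable borel"
    and model: "\<omega> \<in> space M \<Longrightarrow> y i \<omega> = g (x i \<omega>) \<beta>\<^sub>0 + u i \<omega>"
    and u_indep: "indep_set (sets (vimage_algebra (space M) (u i) borel))
                            (sets (vimage_algebra (space M) (\<lambda>\<omega>. (x i \<omega>, a i \<omega>)) borel))"
    and identification: "\<beta> \<in> B \<Longrightarrow> \<beta> \<noteq> \<beta>\<^sub>0 \<Longrightarrow>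
          measure (distr M borel (x 0)) {v. g v \<beta>\<^sub>0 = g v \<beta> + \<alpha>} < 1"
    and gradient: "\<beta> \<in> B \<Longrightarrow> (g v has_derivative (\<lambda>h. gdot v \<beta> \<bullet> h)) (at \<beta> within B)"
    and hessian: "\<beta> \<in> B \<Longrightarrow> (gdot v has_derivative (\<lambda>h. gddot v \<beta> *v h)) (at \<beta> within B)"
    and hessian_continuous: "continuous_on B (gddot v)"
    and moments: "\<exists>\<delta>>0.
          (\<integral>\<^sup>+ v. (SUP \<beta>\<in>B \<inter> cball \<beta>\<^sub>0 \<delta>. ennreal ((norm (gdot v \<beta>))\<^sup>2)) \<partial>distr M borel (x 0)) < \<infinity> \<and>
          (\<integral>\<^sup>+ v. (SUP \<beta>\<in>B \<inter> cball \<beta>\<^sub>0 \<delta>. ennreal (norm (gddot v \<beta>))) \<partial>distr M borel (x 0)) < \<infinity>"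

definition observed_idx :: "(nat \<Rightarrow> 'w \<Rightarrow> real) \<Rightarrow> nat \<Rightarrow> 'w \<Rightarrow> nat set" where
  "observed_idx a n \<omega> = {i. i < n \<and> a i \<omega> = 1}"

definition observed_data ::
  "(nat \<Rightarrow> 'w \<Rightarrow> real ^ 'p) \<Rightarrow> (nat \<Rightarrow> 'w \<Rightarrow> real) \<Rightarrow> (nat \<Rightarrow> 'w \<Rightarrow> real) \<Rightarrow> nat \<Rightarrow> 'w \<Rightarrow>
    (nat \<rightharpoonup> (real ^ 'p) \<times> real)" where
  "observed_data x y a n \<omega> =
    (\<lambda>i. if i \<in> observed_idx a n \<omega> then Some (x i \<omega>, y i \<omega>) else None)"

definition observed_data_estimator ::
  "'w measure \<Rightarrow> (nat \<Rightarrow> 'w \<Rightarrow> real ^ 'p) \<Rightarrow> (nat \<Rightarrow> 'w \<Rightarrow> real) \<Rightarrow> (nat \<Rightarrow> 'w \<Rightarrow> real) \<Rightarrow>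
    (real ^ 'q) set \<Rightarrow> (nat \<Rightarrow> 'w \<Rightarrow> real ^ 'q) \<Rightarrow> bool" where
  "observed_data_estimator M x y a B \<beta>hat \<longleftrightarrow>
    (\<forall>n. \<beta>hat n \<in> borel_measurable M \<and> (\<forall>\<omega>\<in>space M. \<beta>hat n \<omega> \<in> B) \<and>
      (\<exists>est. \<forall>\<omega>\<in>space M. \<beta>hat n \<omega> = est (observed_data x y a n \<omega>)))"

definition uhat ::
  "(real ^ 'p \<Rightarrow> real ^ 'q \<Rightarrow> real) \<Rightarrow> (nat \<Rightarrow> 'w \<Rightarrow> real ^ 'p) \<Rightarrow> (nat \<Rightarrow> 'w \<Rightarrow> real) \<Rightarrow>
    (nat \<Rightarrow> 'w \<Rightarrow> real ^ 'q) \<Rightarrow> nat \<Rightarrow> 'w \<Rightarrow> nat \<Rightarrow> real" where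
  "uhat g x y \<beta>hat n \<omega> i = y i \<omega> - g (x i \<omega>) (\<beta>hat n \<omega>)"

definition yhat ::
  "(real ^ 'p \<Rightarrow> real ^ 'q \<Rightarrow> real) \<Rightarrow> (nat \<Rightarrow> 'w \<Rightarrow> real ^ 'p) \<Rightarrow> (nat \<Rightarrow> 'w \<Rightarrow> real) \<Rightarrow>
    (nat \<Rightarrow> 'w \<Rightarrow> real ^ 'q) \<Rightarrow> nat \<Rightarrow> 'w \<Rightarrow> nat \<Rightarrow> nat \<Rightarrow> real" where
  "yhat g x y \<beta>hat n \<omega> i j = g (x j \<omega>) (\<beta>hat n \<omega>) + uhat g x y \<beta>hat n \<omega> i"

text \<open>
  Pushing the uniform distribution on pairs \<open>(i, j)\<close> forward gives each point mass the weight
  \<open>1 / (n m)\<close>; see \<open>measure_Fhat\<close> below.  If nothing is observed, the result is the zero measure.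
\<close>

definition Fhat ::
  "(real ^ 'p \<Rightarrow> real ^ 'q \<Rightarrow> real) \<Rightarrow> (nat \<Rightarrow> 'w \<Rightarrow> real ^ 'p) \<Rightarrow> (nat \<Rightarrow> 'w \<Rightarrow> real) \<Rightarrow>
    (nat \<Rightarrow> 'w \<Rightarrow> real) \<Rightarrow> (nat \<Rightarrow> 'w \<Rightarrow> real ^ 'q) \<Rightarrow> nat \<Rightarrow> 'w \<Rightarrow> real measure" where
  "Fhat g x y a \<beta>hat n \<omega> =
    distr (uniform_count_measure (observed_idx a n \<omega> \<times> {..<n})) borel
      (\<lambda>(i, j). yhat g x y \<beta>hat n \<omega> i j)"

lemma finite_observed_idx [simp]: "finite (observed_idx a n \<omega>)"
  by (simp add: observed_idx_def)

lemma measure_Fhat: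
  assumes "S \<in> sets borel"
  shows "measure (Fhat g x y a \<beta>hat n \<omega>) S =
    1 / (real n * real (card (observed_idx a n \<omega>))) *
      (\<Sum>i\<in>observed_idx a n \<omega>. \<Sum>j<n. measure (return borel (yhat g x y \<beta>hat n \<omega> i j)) S)"
proof -
  let ?P = "observed_idx a n \<omega> \<times> {..<n}"
  let ?f = "\<lambda>(i, j). yhat g x y \<beta>hat n \<omega> i j"
  have meas: "?f \<in> measurable (uniform_count_measure ?P) borel"
    by (simp add: measurable_def space_uniform_count_measure sets_uniform_count_measure)
  have "measure (Fhat g x y a \<beta>hat n \<omega>) S = measure (uniform_count_measure ?P) (?f -` S \<inter> ?P)"
    unfolding Fhat_def using assms
    by (subst measure_distr[OF meas]) (simp_all add: space_uniform_count_measure)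
  also have "\<dots> = real (card (?f -` S \<inter> ?P)) / real (card ?P)"
    by (rule measure_uniform_count_measure) auto
  also have "real (card (?f -` S \<inter> ?P)) = (\<Sum>p\<in>?P. indicator S (?f p))"
    by (simp add: indicator_def sum.If_cases Int_def conj_commute)
  also have "\<dots> = (\<Sum>i\<in>observed_idx a n \<omega>. \<Sum>j<n. indicator S (yhat g x y \<beta>hat n \<omega> i j))"
    by (simp add: sum.cartesian_product case_prod_beta)
  finally show ?thesis
    using assms by (simp add: measure_return card_cartesian_product mult.commute)
qed

text \<open>
  A univariate distribution is represented by a Borel probability measure on the reals, and a
  functional defined on a class \<open>\<D>\<close> of them by a total function whose values outside \<open>\<D>\<close>
  are irrelevant.  Equivariance is required whenever both sides are defined.
\<close>

definition location_functional :: "real measure set \<Rightarrow> (real measure \<Rightarrow> real) \<Rightarrow> bool" where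
  "location_functional \<D> T \<longleftrightarrow>
    (\<forall>F\<in>\<D>. real_distribution F) \<and>
    (\<forall>F\<in>\<D>. \<forall>a b. distr F borel (\<lambda>t. a * t + b) \<in> \<D> \<longrightarrow>
      T (distr F borel (\<lambda>t. a * t + b)) = a * T F + b)"

definition weakly_continuous_at ::
  "real measure set \<Rightarrow> (real measure \<Rightarrow> real) \<Rightarrow> real measure \<Rightarrow> bool" where
  "weakly_continuous_at \<D> T F \<longleftrightarrow>
    (\<forall>Fs. (\<forall>n. Fs n \<in> \<D>) \<and> weak_conv_m Fs F \<longrightarrow> (\<lambda>n. T (Fs n)) \<longlonglongrightarrow> T F)"

end

theory Submission
  imports Defs
begin

text \<open>
  The measure \<open>Fhat\<close> is the law of the sum of two independent draws: one from the fitted values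
  \<open>g (x j) (\<beta>hat n)\<close>, \<open>j < n\<close>, and one from the residuals of the observed indices.  Its characteristic
  function is therefore a product of two empirical characteristic functions (\<open>char_Fhat\<close>), just as
  the characteristic function of \<open>y = g x \<beta>\<^sub>0 + u\<close> is the product of those of \<open>g x \<beta>\<^sub>0\<close> and \<open>u\<close>
  (\<open>char_y\<close>).  By Levy's continuity theorem it is enough that, almost surely, both factors
  converge at every real argument.

  Suppose first that \<open>\<beta>hat n\<close> is replaced by \<open>\<beta>\<^sub>0\<close>.  The factors then come from the empirical
  distributions of the \<open>g (x j) \<beta>\<^sub>0\<close> and of the observed \<open>u i\<close>.  The strong law for bounded variables
  gives convergence of their distribution functions at all rationals outside one null set, hence
  weak convergence, hence convergence of the characteristic functions at all arguments at once.
  For the errors one averages \<open>a i * indicator {..q} (u i)\<close> and divides by the average of \<open>a i\<close>; since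
  \<open>u\<close> and \<open>a\<close> are independent, the ratio tends to the distribution function of \<open>u\<close>
  (\<open>expectation_a_u\<close>): selecting the observed cases does not bias the error distribution.

  Passing from \<open>\<beta>\<^sub>0\<close> to \<open>\<beta>hat n\<close> changes each point by \<open>g (x i) (\<beta>hat n) - g (x i) \<beta>\<^sub>0\<close>, which alters
  the characteristic functions by at most a constant times the average of these changes truncated
  at \<open>1\<close>.  Truncation makes continuity of \<open>g v\<close> at \<open>\<beta>\<^sub>0\<close> sufficient: the truncated oscillation of
  \<open>g v\<close> over a shrinking ball tends to \<open>0\<close> pointwise and boundedly, so its mean tends to \<open>0\<close>, and by
  the strong law the sample average of the changes is eventually below any such mean plus a small
  margin (\<open>perturbation_average_tendsto_0\<close>).

  The statement on the location functional applies weak continuity to this almost sure limit,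
  after the finitely many \<open>Fhat\<close> outside the class have been replaced by the limit distribution.
\<close>

section \<open>A strong law for bounded variables\<close>

text \<open>
  Hoeffding's inequality makes the probability that the average deviates by \<open>\<epsilon>\<close> geometrically small
  in \<open>n\<close>, hence summable, so the Borel--Cantelli lemma gives almost sure convergence.
\<close>

lemma (in prob_space) strong_law_bounded:
  fixes X :: "nat \<Rightarrow> 'a \<Rightarrow> real"
  assumes indep: "indep_vars (\<lambda>_. borel) X UNIV"
    and range: "\<And>i. AE \<omega> in M. X i \<omega> \<in> {l..h}"
    and mean: "\<And>i. expectation (X i) = \<mu>"
  shows "AE \<omega> in M. (\<lambda>n. (\<Sum>i<n. X i \<omega>) / real n) \<longlonglongrightarrow> \<mu>"
proof -
  \<comment> \<open>Hoeffding's bound needs an interval of positive length, hence the \<open>max\<close>.\<close>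
  define w where "w = max (h - l) 1"
  have w: "w > 0" "h \<le> l + w" by (auto simp: w_def)
  have [measurable]: "random_variable borel (X i)" for i
    using indep by (simp add: indep_vars_def)
  have deviation: "AE \<omega> in M. \<forall>\<^sub>F n in sequentially. \<bar>(\<Sum>i<n. X i \<omega>) / real n - \<mu>\<bar> < \<epsilon>"
    if \<epsilon>: "\<epsilon> > 0" for \<epsilon>
  proof -
    define A where "A n = {\<omega>\<in>space M. \<bar>(\<Sum>i<n. X i \<omega>) - real n * \<mu>\<bar> \<ge> real n * \<epsilon>}" for n
    have [measurable]: "A n \<in> sets M" for n unfolding A_def by measurable
    define c where "c = exp (- (2 * \<epsilon>\<^sup>2 / w\<^sup>2))"
    have c: "\<bar>c\<bar> < 1" using \<epsilon> w by (simp add: c_def)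
    have "prob (A n) \<le> 2 * c ^ n" if "n > 0" for n
    proof -
      interpret Hoeffding_ineq M "{..<n}" X "\<lambda>_. l" "\<lambda>_. l + w" "real n * \<mu>"
      proof unfold_locales
        show "AE \<omega> in M. X i \<omega> \<in> {l..l + w}" for i
          using range[of i] by eventually_elim (use w in auto)
      qed (use indep mean in \<open>auto intro: indep_vars_subset\<close>)
      have "prob (A n) \<le> 2 * exp (-2 * (real n * \<epsilon>)\<^sup>2 / (\<Sum>i<n. (l + w - l)\<^sup>2))"
        unfolding A_def by (rule Hoeffding_ineq_abs_ge) (use \<epsilon> w that in auto)
      also have "-2 * (real n * \<epsilon>)\<^sup>2 / (\<Sum>i<n. (l + w - l)\<^sup>2) = real n * (- (2 * \<epsilon>\<^sup>2 / w\<^sup>2))"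
        using that w by (simp add: field_simps power2_eq_square)
      finally show ?thesis by (simp only: c_def exp_of_nat_mult)
    qed
    then have "\<forall>\<^sub>F n in sequentially. norm (prob (A n)) \<le> 2 * c ^ n"
      by (auto simp: eventually_sequentially intro!: exI[of _ 1])
    then have "summable (\<lambda>n. prob (A n))"
      by (rule summable_comparison_test_ev) (intro summable_mult summable_geometric, use c in simp)
    then have "AE \<omega> in M. \<forall>\<^sub>F n in sequentially. \<omega> \<in> space M - A n"
      by (intro borel_cantelli_AE1) (auto simp: emeasure_eq_measure)
    then show ?thesis
    proof eventually_elim
      case (elim \<omega>)
      show ?case using elim eventually_gt_at_top[of 0]
      proof eventually_elim
        case (elim n)
        then have "\<bar>(\<Sum>i<n. X i \<omega>) - real n * \<mu>\<bar> < real n * \<epsilon>" by (auto simp: A_def)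
        moreover have "(\<Sum>i<n. X i \<omega>) / real n - \<mu> = ((\<Sum>i<n. X i \<omega>) - real n * \<mu>) / real n"
          using elim by (simp add: field_simps)
        ultimately show ?case using elim by (simp add: abs_divide pos_divide_less_eq mult.commute)
      qed
    qed
  qed
  have "AE \<omega> in M. \<forall>k. \<forall>\<^sub>F n in sequentially.
      \<bar>(\<Sum>i<n. X i \<omega>) / real n - \<mu>\<bar> < inverse (real (Suc k))"
    unfolding AE_all_countable by (intro allI deviation) simp
  then show ?thesis
  proof eventually_elim
    case (elim \<omega>)
    show ?case
    proof (rule tendstoI)
      fix e :: real assume "e > 0"
      then obtain k where "inverse (real (Suc k)) < e" using reals_Archimedean by blast
      with elim[rule_format, of k]
      show "\<forall>\<^sub>F n in sequentially. dist ((\<Sum>i<n. X i \<omega>) / real n) \<mu> < e"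
        by (auto simp: dist_real_def elim: eventually_mono)
    qed
  qed
qed

section \<open>Weak convergence\<close>

text \<open>
  Countably many points suffice: a distribution function at \<open>s\<close> lies between its values at rationals
  on either side of \<open>s\<close>, and at a continuity point of the limit these pinch together.  This turns
  countably many almost sure statements into almost sure weak convergence.
\<close>

lemma weak_conv_m_rational_cdf:
  assumes "\<And>n. real_distribution (\<mu> n)" and "real_distribution \<nu>"
    and lim: "\<And>q. q \<in> \<rat> \<Longrightarrow> (\<lambda>n. cdf (\<mu> n) q) \<longlonglongrightarrow> cdf \<nu> q"
  shows "weak_conv_m \<mu> \<nu>"
  unfolding weak_conv_m_def weak_conv_def
proof (intro allI impI)
  fix s assume cont: "isCont (cdf \<nu>) s"
  interpret \<mu>: real_distribution "\<mu> n" for n by fact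
  interpret \<nu>: real_distribution \<nu> by fact
  show "(\<lambda>n. cdf (\<mu> n) s) \<longlonglongrightarrow> cdf \<nu> s"
  proof (rule LIMSEQ_I)
    fix e :: real assume e: "e > 0"
    then obtain d where d: "d > 0"
      and near: "\<And>t. \<bar>t - s\<bar> < d \<Longrightarrow> \<bar>cdf \<nu> t - cdf \<nu> s\<bar> < e / 2"
      using cont[unfolded continuous_at_eps_delta] by (metis half_gt_zero dist_real_def)
    obtain p where p: "p \<in> \<rat>" "s - d < p" "p < s" using Rats_dense_in_real[of "s - d" s] d by auto
    obtain q where q: "q \<in> \<rat>" "s < q" "q < s + d" using Rats_dense_in_real[of s "s + d"] d by auto
    from e have "e / 2 > 0" by simp
    from LIMSEQ_D[OF lim[OF p(1)] this] LIMSEQ_D[OF lim[OF q(1)] this]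
    obtain N1 N2 where N: "\<And>n. n \<ge> N1 \<Longrightarrow> \<bar>cdf (\<mu> n) p - cdf \<nu> p\<bar> < e / 2"
      "\<And>n. n \<ge> N2 \<Longrightarrow> \<bar>cdf (\<mu> n) q - cdf \<nu> q\<bar> < e / 2" by auto
    have "\<bar>cdf (\<mu> n) s - cdf \<nu> s\<bar> < e" if "n \<ge> max N1 N2" for n
      using N(1)[of n] N(2)[of n] near[of p] near[of q] p q that
        \<mu>.cdf_nondecreasing[of p s n] \<mu>.cdf_nondecreasing[of s q n] by (auto simp: abs_if split: if_splits)
    then show "\<exists>N. \<forall>n\<ge>N. norm (cdf (\<mu> n) s - cdf \<nu> s) < e" by (metis real_norm_def)
  qed
qed

lemma weak_conv_m_eventually_cong:
  "\<forall>\<^sub>F n in sequentially. \<mu> n = \<mu>' n \<Longrightarrow> weak_conv_m \<mu> \<nu> \<longleftrightarrow> weak_conv_m \<mu>' \<nu>"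
  unfolding weak_conv_m_def weak_conv_def
  by (intro all_cong1 imp_cong refl tendsto_cong) (auto elim: eventually_mono)

text \<open>
  Weak convergence ignores finitely many terms, so a probability measure is needed only for
  large \<open>n\<close>.  This matters because \<open>Fhat\<close> is the zero measure as long as no response is observed.
\<close>

lemma levy_continuity_eventually:
  assumes distr: "\<forall>\<^sub>F n in sequentially. real_distribution (\<mu> n)" and \<nu>: "real_distribution \<nu>"
    and char: "\<And>t. (\<lambda>n. char (\<mu> n) t) \<longlonglongrightarrow> char \<nu> t"
  shows "weak_conv_m \<mu> \<nu>"
proof -
  define \<mu>' where "\<mu>' n = (if real_distribution (\<mu> n) then \<mu> n else \<nu>)" for n
  have ev: "\<forall>\<^sub>F n in sequentially. \<mu> n = \<mu>' n"
    using distr by eventually_elim (simp add: \<mu>'_def)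
  have "weak_conv_m \<mu>' \<nu>"
  proof (rule levy_continuity[OF _ \<nu>])
    show "(\<lambda>n. char (\<mu>' n) t) \<longlonglongrightarrow> char \<nu> t" for t
      by (rule Lim_transform_eventually[OF char]) (use ev in eventually_elim, simp)
  qed (simp add: \<mu>'_def \<nu>)
  then show ?thesis using weak_conv_m_eventually_cong[OF ev] by simp
qed

lemma weakly_continuous_at_eventually:
  assumes T: "weakly_continuous_at \<D> T \<nu>" and \<nu>: "\<nu> \<in> \<D>"
    and \<D>: "\<forall>\<^sub>F n in sequentially. \<mu> n \<in> \<D>" and conv: "weak_conv_m \<mu> \<nu>"
  shows "(\<lambda>n. T (\<mu> n)) \<longlonglongrightarrow> T \<nu>"
proof -
  define \<mu>' where "\<mu>' n = (if \<mu> n \<in> \<D> then \<mu> n else \<nu>)" for n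
  have ev: "\<forall>\<^sub>F n in sequentially. \<mu>' n = \<mu> n"
    using \<D> by eventually_elim (simp add: \<mu>'_def)
  have "weak_conv_m \<mu>' \<nu>" using conv weak_conv_m_eventually_cong[OF ev] by simp
  moreover have "\<mu>' n \<in> \<D>" for n using \<nu> by (simp add: \<mu>'_def)
  ultimately have "(\<lambda>n. T (\<mu>' n)) \<longlonglongrightarrow> T \<nu>"
    using T unfolding weakly_continuous_at_def by blast
  then show ?thesis
    by (rule Lim_transform_eventually) (use ev in eventually_elim, simp)
qed

section \<open>Empirical distributions\<close>

text \<open>
  For an empty index set this is the zero measure.
\<close>

definition empirical :: "'i set \<Rightarrow> ('i \<Rightarrow> real) \<Rightarrow> real measure" where
  "empirical I f = distr (uniform_count_measure I) borel f"

lemma measurable_uniform_count_measure [simp]: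
  "f \<in> measurable (uniform_count_measure I) borel"
  by (simp add: measurable_def space_uniform_count_measure sets_uniform_count_measure)

lemma real_distribution_empirical:
  "finite I \<Longrightarrow> I \<noteq> {} \<Longrightarrow> real_distribution (empirical I f)"
  unfolding empirical_def
  by (intro prob_space.real_distribution_distr prob_space_uniform_count_measure) auto

lemma char_empirical:
  "finite I \<Longrightarrow> char (empirical I f) t = (\<Sum>i\<in>I. iexp (t * f i)) / card I"
proof -
  assume I: "finite I"
  have "char (empirical I f) t = (CLINT i|uniform_count_measure I. iexp (t * f i))"
    unfolding char_def empirical_def by (rule integral_distr) auto
  also have "\<dots> = (\<Sum>i\<in>I. iexp (t * f i) / card I)"
    using I by (simp add: uniform_count_measure_def lebesgue_integral_point_measure_finite
        scaleR_conv_of_real divide_simps)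
  finally show ?thesis by (simp only: sum_divide_distrib)
qed

lemma cdf_empirical:
  assumes "finite I"
  shows "cdf (empirical I f) s = (\<Sum>i\<in>I. indicator {..s} (f i)) / card I"
proof -
  have "cdf (empirical I f) s = measure (uniform_count_measure I) (f -` {..s} \<inter> I)"
    by (simp add: cdf_def empirical_def measure_distr space_uniform_count_measure)
  also have "\<dots> = real (card (f -` {..s} \<inter> I)) / card I"
    using assms by (intro measure_uniform_count_measure) auto
  also have "real (card (f -` {..s} \<inter> I)) = (\<Sum>i\<in>I. indicator {..s} (f i))"
    using assms by (simp add: indicator_def sum.If_cases Int_def conj_commute)
  finally show ?thesis .
qed

text \<open>
  All sums \<open>f i + e j\<close> with equal weights form the convolution of the two empirical distributions.
\<close>

lemma char_empirical_add:
  assumes "finite I" "finite J"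
  shows "char (empirical (I \<times> J) (\<lambda>(i, j). f i + e j)) t =
    char (empirical I f) t * char (empirical J e) t"
proof -
  have "(\<Sum>p\<in>I \<times> J. iexp (t * (case p of (i, j) \<Rightarrow> f i + e j))) =
      (\<Sum>i\<in>I. \<Sum>j\<in>J. iexp (t * f i) * iexp (t * e j))"
    by (simp add: sum.cartesian_product case_prod_beta distrib_left exp_add)
  then show ?thesis
    using assms by (simp add: char_empirical card_cartesian_product sum_product)
qed

text \<open>
  Truncation at \<open>1\<close> costs only the constant because the left-hand side never exceeds \<open>2\<close>.
\<close>

lemma iexp_diff_le: "cmod (iexp (t * r) - iexp (t * s)) \<le> max 2 \<bar>t\<bar> * min 1 \<bar>r - s\<bar>"
proof -
  have "iexp (t * r) - iexp (t * s) = iexp (t * s) * (iexp (t * (r - s)) - 1)"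
    by (simp add: right_diff_distrib flip: exp_add)
  then have eq: "cmod (iexp (t * r) - iexp (t * s)) = cmod (iexp (t * (r - s)) - 1)"
    by (simp add: norm_mult)
  have "cmod (iexp (t * (r - s)) - 1) \<le> \<bar>t\<bar> * \<bar>r - s\<bar>"
    using iexp_approx1[of "t * (r - s)" 0] by (simp add: abs_mult)
  also have "\<dots> \<le> max 2 \<bar>t\<bar> * \<bar>r - s\<bar>" by (intro mult_right_mono) auto
  finally have "cmod (iexp (t * (r - s)) - 1) \<le> max 2 \<bar>t\<bar> * \<bar>r - s\<bar>" .
  moreover have "cmod (iexp (t * (r - s)) - 1) \<le> max 2 \<bar>t\<bar>"
    using norm_triangle_ineq4[of "iexp (t * (r - s))" 1] by simp
  ultimately show ?thesis unfolding eq by (simp add: min_def)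
qed

text \<open>
  The data points may move with \<open>n\<close>, as residuals and fitted values do.  Their limit is decided by the
  fixed points \<open>f\<close>, as long as the truncated displacements vanish on average.
\<close>

lemma char_empirical_tendsto:
  fixes f :: "'i \<Rightarrow> real" and f' :: "nat \<Rightarrow> 'i \<Rightarrow> real"
  assumes fin: "\<And>n. finite (I n)" and ne: "\<forall>\<^sub>F n in sequentially. I n \<noteq> {}"
    and \<nu>: "real_distribution \<nu>"
    and cdf: "\<And>q. q \<in> \<rat> \<Longrightarrow>
      (\<lambda>n. (\<Sum>i\<in>I n. indicator {..q} (f i)) / card (I n)) \<longlonglongrightarrow> cdf \<nu> q"
    and close: "(\<lambda>n. (\<Sum>i\<in>I n. min 1 \<bar>f' n i - f i\<bar>) / card (I n)) \<longlonglongrightarrow> 0"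
  shows "(\<lambda>n. char (empirical (I n) (f' n)) t) \<longlonglongrightarrow> char \<nu> t"
proof -
  define \<mu> where "\<mu> n = (if I n \<noteq> {} then empirical (I n) f else \<nu>)" for n
  have \<mu>_ev: "\<forall>\<^sub>F n in sequentially. \<mu> n = empirical (I n) f"
    using ne by eventually_elim (simp add: \<mu>_def)
  have \<mu>_distr: "real_distribution (\<mu> n)" for n
    using fin \<nu> by (simp add: \<mu>_def real_distribution_empirical)
  have "weak_conv_m \<mu> \<nu>"
  proof (rule weak_conv_m_rational_cdf[OF \<mu>_distr \<nu>])
    fix q :: real assume "q \<in> \<rat>"
    have "\<forall>\<^sub>F n in sequentially. (\<Sum>i\<in>I n. indicator {..q} (f i)) / card (I n) = cdf (\<mu> n) q"
      using \<mu>_ev by eventually_elim (simp add: cdf_empirical fin)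
    with cdf[OF \<open>q \<in> \<rat>\<close>] show "(\<lambda>n. cdf (\<mu> n) q) \<longlonglongrightarrow> cdf \<nu> q"
      by (rule Lim_transform_eventually)
  qed
  then have "(\<lambda>n. char (\<mu> n) t) \<longlonglongrightarrow> char \<nu> t"
    by (rule levy_continuity1[OF \<mu>_distr \<nu>])
  moreover have "\<forall>\<^sub>F n in sequentially. char (\<mu> n) t = char (empirical (I n) f) t"
    using \<mu>_ev by eventually_elim simp
  ultimately have base: "(\<lambda>n. char (empirical (I n) f) t) \<longlonglongrightarrow> char \<nu> t"
    by (rule Lim_transform_eventually)
  have bound: "cmod (char (empirical (I n) (f' n)) t - char (empirical (I n) f) t) \<le>
      max 2 \<bar>t\<bar> * ((\<Sum>i\<in>I n. min 1 \<bar>f' n i - f i\<bar>) / card (I n))" for n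
  proof -
    have "cmod (char (empirical (I n) (f' n)) t - char (empirical (I n) f) t) =
        cmod (\<Sum>i\<in>I n. iexp (t * f' n i) - iexp (t * f i)) / card (I n)"
      using fin by (simp add: char_empirical sum_subtractf norm_divide flip: diff_divide_distrib)
    also have "\<dots> \<le> (\<Sum>i\<in>I n. max 2 \<bar>t\<bar> * min 1 \<bar>f' n i - f i\<bar>) / card (I n)"
      by (intro divide_right_mono sum_norm_le iexp_diff_le) auto
    finally show ?thesis by (simp add: sum_distrib_left)
  qed
  have "(\<lambda>n. max 2 \<bar>t\<bar> * ((\<Sum>i\<in>I n. min 1 \<bar>f' n i - f i\<bar>) / card (I n))) \<longlonglongrightarrow> 0"
    using tendsto_mult_right_zero[OF close] by simp
  then have "(\<lambda>n. char (empirical (I n) (f' n)) t - char (empirical (I n) f) t) \<longlonglongrightarrow> 0"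
    by (rule Lim_null_comparison[rotated]) (intro always_eventually allI bound)
  from tendsto_add[OF this base] show ?thesis by simp
qed

section \<open>A measurable modulus of continuity\<close>

text \<open>
  The function \<open>h k\<close> is the supremum of the truncated oscillation over the part of \<open>B\<close> within
  \<open>1 / (k + 1)\<close> of \<open>b\<close>.  An uncountable supremum need not be measurable, so it is taken over a countable
  dense subset, and continuity carries the bound over to the other parameters.
\<close>

lemma measurable_continuity_modulus:
  fixes g :: "'v::topological_space \<Rightarrow> 'b::{metric_space, second_countable_topology} \<Rightarrow> real"
  assumes b: "b \<in> B"
    and meas: "\<And>\<beta>. \<beta> \<in> B \<Longrightarrow> (\<lambda>v. g v \<beta>) \<in> borel_measurable borel"
    and cont: "\<And>v. continuous_on B (g v)"
  obtains h :: "nat \<Rightarrow> 'v \<Rightarrow> real"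
  where "\<And>k. h k \<in> borel_measurable borel" and "\<And>k v. h k v \<in> {0..1}"
    and "\<And>v. (\<lambda>k. h k v) \<longlonglongrightarrow> 0"
    and "\<And>k v \<beta>. \<beta> \<in> B \<Longrightarrow> dist b \<beta> \<le> inverse (Suc k) \<Longrightarrow> min 1 \<bar>g v \<beta> - g v b\<bar> \<le> h k v"
proof -
  define C where "C k = B \<inter> cball b (inverse (Suc k))" for k :: nat
  have "\<exists>D. countable D \<and> D \<subseteq> C k \<and> C k \<subseteq> closure D" for k
    by (metis separable)
  then obtain D where D: "\<And>k. countable (D k)" "\<And>k. D k \<subseteq> C k" "\<And>k. C k \<subseteq> closure (D k)"
    by metis
  have bC: "b \<in> C k" for k using b by (simp add: C_def)
  have D_ne: "D k \<noteq> {}" for k using D(3)[of k] bC[of k] by auto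
  have DB: "\<beta> \<in> B" if "\<beta> \<in> D k" for k \<beta> using D(2)[of k] that by (auto simp: C_def)
  define h where "h k v = (SUP \<beta>\<in>D k. min 1 \<bar>g v \<beta> - g v b\<bar>)" for k v
  have bdd: "bdd_above ((\<lambda>\<beta>. min 1 \<bar>g v \<beta> - g v b\<bar>) ` S)" for v S
    by (rule bdd_aboveI[of _ 1]) auto
  have upper: "min 1 \<bar>g v \<beta> - g v b\<bar> \<le> h k v" if "\<beta> \<in> D k" for k v \<beta>
    unfolding h_def by (rule cSUP_upper[OF that bdd])
  show ?thesis
  proof (rule that[of h])
    show "h k \<in> borel_measurable borel" for k
      unfolding h_def using D(1) b DB by (intro borel_measurable_cSUP bdd) (auto intro!: meas borel_measurable_min borel_measurable_abs borel_measurable_diff)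
    show "h k v \<in> {0..1}" for k v
    proof -
      obtain \<beta> where "\<beta> \<in> D k" using D_ne[of k] by auto
      from upper[OF this, of v] have "0 \<le> h k v" by (rule order.trans[rotated]) simp
      moreover have "h k v \<le> 1" unfolding h_def by (rule cSUP_least[OF D_ne]) simp
      ultimately show ?thesis by simp
    qed
    then have h0: "0 \<le> h k v" for k v by simp
    show "(\<lambda>k. h k v) \<longlonglongrightarrow> 0" for v
    proof (rule LIMSEQ_I)
      fix e :: real assume e: "e > 0"
      from cont[of v, unfolded continuous_on_iff, rule_format, OF b, of "e / 2"] e
      obtain d where d: "d > 0" "\<And>\<beta>. \<beta> \<in> B \<Longrightarrow> dist \<beta> b < d \<Longrightarrow> \<bar>g v \<beta> - g v b\<bar> < e / 2"
        by (auto simp: dist_real_def)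
      obtain N where N: "inverse (real (Suc N)) < d" using reals_Archimedean[OF d(1)] by blast
      have "h k v \<le> e / 2" if k: "k \<ge> N" for k
        unfolding h_def
      proof (rule cSUP_least[OF D_ne])
        fix \<beta> assume \<beta>: "\<beta> \<in> D k"
        then have "dist \<beta> b \<le> inverse (real (Suc k))"
          using D(2)[of k] by (auto simp: C_def dist_commute)
        also have "\<dots> \<le> inverse (real (Suc N))" using k by simp
        finally have "dist \<beta> b < d" using N by simp
        with d(2)[OF DB[OF \<beta>]] show "min 1 \<bar>g v \<beta> - g v b\<bar> \<le> e / 2"
          by (meson less_imp_le min.coboundedI2)
      qed
      then show "\<exists>N. \<forall>k\<ge>N. norm (h k v - 0) < e"
        using e h0 by (intro exI[of _ N]) (fastforce simp: abs_of_nonneg)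
    qed
    show "min 1 \<bar>g v \<beta> - g v b\<bar> \<le> h k v" if \<beta>: "\<beta> \<in> B" "dist b \<beta> \<le> inverse (Suc k)" for k v \<beta>
    proof -
      have "\<beta> \<in> closure (D k)" using D(3)[of k] \<beta> by (auto simp: C_def)
      then obtain s where s: "\<And>n. s n \<in> D k" "s \<longlonglongrightarrow> \<beta>" unfolding closure_sequential by auto
      have "(\<lambda>n. g v (s n)) \<longlonglongrightarrow> g v \<beta>"
        using cont[of v] s \<beta> DB[OF s(1)] by (intro continuous_on_tendsto_compose[of B "g v"]) auto
      then have "(\<lambda>n. min 1 \<bar>g v (s n) - g v b\<bar>) \<longlonglongrightarrow> min 1 \<bar>g v \<beta> - g v b\<bar>"
        by (intro tendsto_intros)
      then show ?thesis using upper[OF s(1)] by (intro LIMSEQ_le_const2) auto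
    qed
  qed
qed

section \<open>The missing data model\<close>

context missing_data_model
begin

lemma random_variable_x [measurable]: "x i \<in> borel_measurable M"
  and random_variable_y [measurable]: "y i \<in> borel_measurable M"
  and random_variable_a [measurable]: "a i \<in> borel_measurable M"
proof -
  have "(\<lambda>\<omega>. (x i \<omega>, y i \<omega>, a i \<omega>)) \<in> borel_measurable M"
    using indep by (simp add: indep_vars_def)
  then have "(\<lambda>\<omega>. (x i \<omega>, y i \<omega>, a i \<omega>)) \<in> M \<rightarrow>\<^sub>M borel \<Otimes>\<^sub>M borel \<Otimes>\<^sub>M borel"
    by (simp only: borel_prod)
  from measurable_fst'[OF this] measurable_fst'[OF measurable_snd'[OF this]]
    measurable_snd'[OF measurable_snd'[OF this]]
  show "x i \<in> borel_measurable M" "y i \<in> borel_measurable M" "a i \<in> borel_measurable M"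
    by simp_all
qed

lemma g_measurable_beta0 [measurable]: "(\<lambda>v. g v \<beta>\<^sub>0) \<in> borel_measurable borel"
  by (rule g_measurable[OF \<beta>\<^sub>0_in])

lemma u_eq: "\<omega> \<in> space M \<Longrightarrow> u i \<omega> = y i \<omega> - g (x i \<omega>) \<beta>\<^sub>0"
  using model[of \<omega> i] by simp

lemma random_variable_u [measurable]: "u i \<in> borel_measurable M"
  by (subst measurable_cong[OF u_eq]) measurable

lemma average_tendsto:
  fixes \<phi> :: "(real ^ 'p) \<times> real \<times> real \<Rightarrow> real"
  assumes \<phi>: "\<phi> \<in> borel \<Otimes>\<^sub>M borel \<Otimes>\<^sub>M borel \<rightarrow>\<^sub>M borel"
    and range: "\<And>i \<omega>. \<omega> \<in> space M \<Longrightarrow> \<phi> (x i \<omega>, y i \<omega>, a i \<omega>) \<in> {0..1}"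
  shows "AE \<omega> in M. (\<lambda>n. (\<Sum>i<n. \<phi> (x i \<omega>, y i \<omega>, a i \<omega>)) / real n)
    \<longlonglongrightarrow> expectation (\<lambda>\<omega>. \<phi> (x 0 \<omega>, y 0 \<omega>, a 0 \<omega>))"
proof (rule strong_law_bounded)
  from \<phi> have \<phi>: "\<phi> \<in> borel_measurable borel" by (simp only: borel_prod)
  show "indep_vars (\<lambda>_. borel) (\<lambda>i \<omega>. \<phi> (x i \<omega>, y i \<omega>, a i \<omega>)) UNIV"
    by (rule indep_vars_compose2[OF indep \<phi>])
  show "AE \<omega> in M. \<phi> (x i \<omega>, y i \<omega>, a i \<omega>) \<in> {0..1}" for i
    using range by (intro AE_I2)
  have Z: "(\<lambda>\<omega>. (x i \<omega>, y i \<omega>, a i \<omega>)) \<in> borel_measurable M" for i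
    using indep by (simp add: indep_vars_def)
  show "expectation (\<lambda>\<omega>. \<phi> (x i \<omega>, y i \<omega>, a i \<omega>)) =
      expectation (\<lambda>\<omega>. \<phi> (x 0 \<omega>, y 0 \<omega>, a 0 \<omega>))" for i
    using integral_distr[OF Z[of i] \<phi>] integral_distr[OF Z[of 0] \<phi>] ident_distr[of i] by simp
qed

text \<open>
  This moves the randomness from the range of summation to the weights, as the strong law requires.
\<close>

lemma sum_observed_idx:
  assumes "\<omega> \<in> space M"
  shows "(\<Sum>i\<in>observed_idx a n \<omega>. f i) = (\<Sum>i<n. a i \<omega> * f i)"
proof -
  have "(\<Sum>i<n. a i \<omega> * f i) = (\<Sum>i<n. if a i \<omega> = 1 then f i else 0)"
    using a_01[OF assms] by (intro sum.cong) auto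
  also have "\<dots> = (\<Sum>i\<in>observed_idx a n \<omega>. f i)"
    by (simp add: sum.If_cases observed_idx_def Int_def)
  finally show ?thesis by simp
qed

text \<open>
  As \<open>a\<close> is an indicator, both sides are probabilities, and the identity is the product rule for the
  independent events \<open>u \<le> q\<close> and \<open>a = 1\<close>.
\<close>

lemma expectation_a_u:
  "expectation (\<lambda>\<omega>. a 0 \<omega> * indicator {..q} (u 0 \<omega>)) =
    expectation (a 0) * cdf (distr M borel (u 0)) q"
proof -
  let ?U = "u 0 -` {..q} \<inter> space M" and ?A = "(\<lambda>\<omega>. (x 0 \<omega>, a 0 \<omega>)) -` (UNIV \<times> {1}) \<inter> space M"
  have [measurable]: "?U \<in> events" "?A \<in> events"
    by (auto intro!: measurable_sets[OF random_variable_u] measurable_sets[where A = borel])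
  have "expectation (\<lambda>\<omega>. a 0 \<omega> * indicator {..q} (u 0 \<omega>)) =
      expectation (indicator (?U \<inter> ?A))"
    using a_01[of _ 0] by (intro Bochner_Integration.integral_cong) (force simp: indicator_def)+
  also have "\<dots> = prob (?U \<inter> ?A)" by simp
  also have "\<dots> = prob ?U * prob ?A"
    using closed_Times[of "UNIV :: (real ^ 'p) set" "{1::real}"]
    by (intro indep_setD[OF u_indep[of 0]]) (auto intro!: in_vimage_algebra borel_closed)
  also have "prob ?U = cdf (distr M borel (u 0)) q" by (simp add: cdf_def measure_distr)
  also have "prob ?A = expectation (indicator ?A)" by simp
  also have "\<dots> = expectation (a 0)"
    using a_01[of _ 0] by (intro Bochner_Integration.integral_cong) (force simp: indicator_def)+
  finally show ?thesis by (simp add: mult.commute)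
qed

text \<open>
  The \<open>\<sigma>\<close>-algebra of \<open>g x \<beta>\<^sub>0\<close> is contained in that of \<open>(x, a)\<close>, which is independent of \<open>u\<close>.
\<close>

lemma indep_regression_error: "indep_var borel (\<lambda>\<omega>. g (x 0 \<omega>) \<beta>\<^sub>0) borel (u 0)"
proof -
  let ?R = "\<lambda>\<omega>. g (x 0 \<omega>) \<beta>\<^sub>0" and ?Z = "\<lambda>\<omega>. (x 0 \<omega>, a 0 \<omega>)"
  have sub: "sets (vimage_algebra (space M) ?R borel) \<subseteq> sets (vimage_algebra (space M) ?Z borel)"
    unfolding sets_vimage_algebra[of _ ?R]
  proof (rule sets.sigma_sets_subset')
    show "{?R -` A \<inter> space M |A. A \<in> sets borel} \<subseteq> sets (vimage_algebra (space M) ?Z borel)"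
    proof safe
      fix A :: "real set" assume A: "A \<in> sets borel"
      have "(\<lambda>z. g (fst z) \<beta>\<^sub>0) \<in> borel \<Otimes>\<^sub>M (borel :: real measure) \<rightarrow>\<^sub>M borel"
        by measurable
      then have "(\<lambda>z. g (fst z) \<beta>\<^sub>0) \<in> borel_measurable (borel :: ((real ^ 'p) \<times> real) measure)"
        by (simp only: borel_prod)
      from measurable_sets[OF this A]
      have "(\<lambda>z. g (fst z) \<beta>\<^sub>0) -` A \<in> sets (borel :: ((real ^ 'p) \<times> real) measure)"
        by simp
      from in_vimage_algebra[OF this, of ?Z "space M"]
      show "?R -` A \<inter> space M \<in> sets (vimage_algebra (space M) ?Z borel)"
        by (simp add: vimage_def)
    qed
    show "space M \<in> sets (vimage_algebra (space M) ?Z borel)"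
      using sets.top[of "vimage_algebra (space M) ?Z borel"] by (simp only: space_vimage_algebra)
  qed
  have "indep_set (sets (vimage_algebra (space M) ?R borel))
      (sets (vimage_algebra (space M) (u 0) borel))"
    unfolding indep_sets2_eq
  proof (intro conjI ballI)
    note ev = indep_sets2_eq[THEN iffD1, OF u_indep[of 0]]
    show "sets (vimage_algebra (space M) ?R borel) \<subseteq> events"
      "sets (vimage_algebra (space M) (u 0) borel) \<subseteq> events"
      using ev sub by auto
    fix R U assume "R \<in> sets (vimage_algebra (space M) ?R borel)"
      "U \<in> sets (vimage_algebra (space M) (u 0) borel)"
    then have "prob (U \<inter> R) = prob U * prob R"
      using sub by (intro indep_setD[OF u_indep[of 0]]) auto
    then show "prob (R \<inter> U) = prob R * prob U" by (simp only: Int_commute mult.commute)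
  qed
  then show ?thesis unfolding indep_var_eq sets_vimage_algebra by simp
qed

lemma char_y:
  "char (distr M borel (y 0)) t =
    char (distr M borel (\<lambda>\<omega>. g (x 0 \<omega>) \<beta>\<^sub>0)) t * char (distr M borel (u 0)) t"
proof -
  have "distr M borel (y 0) = distr M borel (\<lambda>\<omega>. g (x 0 \<omega>) \<beta>\<^sub>0 + u 0 \<omega>)"
    by (rule distr_cong) (simp_all add: model)
  then show ?thesis using char_distr_add[OF indep_regression_error] by simp
qed


lemma char_Fhat:
  "char (Fhat g x y a \<beta>hat n \<omega>) t =
    char (empirical {..<n} (\<lambda>j. g (x j \<omega>) (\<beta>hat n \<omega>))) t *
    char (empirical (observed_idx a n \<omega>) (uhat g x y \<beta>hat n \<omega>)) t"
proof -
  have "Fhat g x y a \<beta>hat n \<omega> = empirical (observed_idx a n \<omega> \<times> {..<n})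
      (\<lambda>(i, j). uhat g x y \<beta>hat n \<omega> i + g (x j \<omega>) (\<beta>hat n \<omega>))"
    by (simp add: Fhat_def empirical_def yhat_def add.commute)
  then show ?thesis by (simp add: char_empirical_add mult.commute)
qed

text \<open>
  By strong consistency \<open>\<beta>hat n\<close> eventually lies in every ball around \<open>\<beta>\<^sub>0\<close>.  Since \<open>\<beta>hat n\<close> depends on all of the data, the summands are
  not independent in general, and the strong law is applied instead to the moduli of continuity on
  these balls, which do not involve \<open>\<beta>hat\<close>.
\<close>

lemma perturbation_average_tendsto_0:
  assumes \<beta>hat: "\<forall>n. \<forall>\<omega>\<in>space M. \<beta>hat n \<omega> \<in> B"
    and consistent: "AE \<omega> in M. (\<lambda>n. \<beta>hat n \<omega>) \<longlonglongrightarrow> \<beta>\<^sub>0"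
  shows "AE \<omega> in M.
    (\<lambda>n. (\<Sum>i<n. min 1 \<bar>g (x i \<omega>) (\<beta>hat n \<omega>) - g (x i \<omega>) \<beta>\<^sub>0\<bar>) / real n) \<longlonglongrightarrow> 0"
proof -
  have "continuous_on B (g v)" for v
    using gradient has_derivative_continuous by (metis continuous_on_eq_continuous_within)
  from measurable_continuity_modulus[OF \<beta>\<^sub>0_in g_measurable this]
  obtain h where h [measurable]: "\<And>k. h k \<in> borel_measurable borel"
    and h01: "\<And>k v. h k v \<in> {0..1::real}"
    and h0: "\<And>v. (\<lambda>k. h k v) \<longlonglongrightarrow> 0"
    and modulus: "\<And>k v \<beta>. \<beta> \<in> B \<Longrightarrow> dist \<beta>\<^sub>0 \<beta> \<le> inverse (real (Suc k)) \<Longrightarrow>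
      min 1 \<bar>g v \<beta> - g v \<beta>\<^sub>0\<bar> \<le> h k v"
    by (metis of_nat_Suc)
  have mean0: "(\<lambda>k. expectation (\<lambda>\<omega>. h k (x 0 \<omega>))) \<longlonglongrightarrow> expectation (\<lambda>\<omega>. 0)"
    using h01 by (intro integral_dominated_convergence[where w = "\<lambda>_. 1"]) (auto simp: h0)
  have "AE \<omega> in M. (\<lambda>n. (\<Sum>i<n. h k (x i \<omega>)) / real n) \<longlonglongrightarrow> expectation (\<lambda>\<omega>. h k (x 0 \<omega>))" for k
    using average_tendsto[of "\<lambda>z. h k (fst z)", OF measurable_compose[OF measurable_fst h]] h01 by simp
  then have "AE \<omega> in M. \<forall>k. (\<lambda>n. (\<Sum>i<n. h k (x i \<omega>)) / real n)
      \<longlonglongrightarrow> expectation (\<lambda>\<omega>. h k (x 0 \<omega>))"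
    unfolding AE_all_countable by blast
  with consistent AE_space show ?thesis
  proof eventually_elim
    case (elim \<omega>)
    let ?D = "\<lambda>n. (\<Sum>i<n. min 1 \<bar>g (x i \<omega>) (\<beta>hat n \<omega>) - g (x i \<omega>) \<beta>\<^sub>0\<bar>) / real n"
    show "?D \<longlonglongrightarrow> 0"
    proof (rule order_tendstoI)
      fix e :: real assume "e > 0"
      with mean0 have "\<forall>\<^sub>F k in sequentially. expectation (\<lambda>\<omega>. h k (x 0 \<omega>)) < e"
        by (intro order_tendstoD(2)) auto
      then obtain k where "expectation (\<lambda>\<omega>. h k (x 0 \<omega>)) < e"
        by (auto simp: eventually_sequentially)
      then have "\<forall>\<^sub>F n in sequentially. (\<Sum>i<n. h k (x i \<omega>)) / real n < e"
        using elim by (intro order_tendstoD(2)[of _ "expectation (\<lambda>\<omega>. h k (x 0 \<omega>))"]) auto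
      moreover have "\<forall>\<^sub>F n in sequentially. dist (\<beta>hat n \<omega>) \<beta>\<^sub>0 < inverse (real (Suc k))"
        using elim by (intro tendstoD) auto
      ultimately show "\<forall>\<^sub>F n in sequentially. ?D n < e"
      proof eventually_elim
        case (elim n)
        have "?D n \<le> (\<Sum>i<n. h k (x i \<omega>)) / real n"
          using elim \<beta>hat \<open>\<omega> \<in> space M\<close>
          by (intro divide_right_mono sum_mono modulus) (auto simp: dist_commute)
        with elim show ?case by simp
      qed
    next
      fix e :: real assume "e < 0"
      moreover have "0 \<le> ?D n" for n by (intro divide_nonneg_nonneg sum_nonneg) auto
      ultimately have "e < ?D n" for n by (rule less_le_trans)
      then show "\<forall>\<^sub>F n in sequentially. e < ?D n" by (intro always_eventually allI)
    qed
  qed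
qed

text \<open>
  A single null set serves for all \<open>t\<close>, because the strong law is used only for countably many
  functions: the indicators at rational \<open>q\<close>, the variables \<open>a i\<close>, and the moduli of continuity.
\<close>

lemma char_Fhat_tendsto:
  assumes \<beta>hat: "\<forall>n. \<forall>\<omega>\<in>space M. \<beta>hat n \<omega> \<in> B"
    and consistent: "AE \<omega> in M. (\<lambda>n. \<beta>hat n \<omega>) \<longlonglongrightarrow> \<beta>\<^sub>0"
  shows "AE \<omega> in M. (\<forall>\<^sub>F n in sequentially. real_distribution (Fhat g x y a \<beta>hat n \<omega>)) \<and>
    (\<forall>t. (\<lambda>n. char (Fhat g x y a \<beta>hat n \<omega>) t) \<longlonglongrightarrow> char (distr M borel (y 0)) t)"
proof -
  let ?r = "\<lambda>i \<omega>. g (x i \<omega>) \<beta>\<^sub>0" and ?\<eta> = "expectation (a 0)"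
  have a_average: "AE \<omega> in M. (\<lambda>n. (\<Sum>i<n. a i \<omega>) / real n) \<longlonglongrightarrow> ?\<eta>"
  proof -
    have "a i \<omega> \<in> {0..1}" if "\<omega> \<in> space M" for i \<omega> using a_01[OF that, of i] by auto
    then show ?thesis using average_tendsto[of "\<lambda>z. snd (snd z)"] by simp
  qed
  have u_average: "AE \<omega> in M. \<forall>q\<in>\<rat>. (\<lambda>n. (\<Sum>i<n. a i \<omega> * indicator {..q} (u i \<omega>)) / real n)
      \<longlonglongrightarrow> ?\<eta> * cdf (distr M borel (u 0)) q"
  proof (rule AE_ball_countable'[OF _ countable_rat])
    fix q :: real
    let ?\<phi> = "\<lambda>z :: (real ^ 'p) \<times> real \<times> real.
      snd (snd z) * indicator {..q} (fst (snd z) - g (fst z) \<beta>\<^sub>0)"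
    have \<phi>: "?\<phi> \<in> borel \<Otimes>\<^sub>M borel \<Otimes>\<^sub>M borel \<rightarrow>\<^sub>M borel" by measurable
    have eq: "?\<phi> (x i \<omega>, y i \<omega>, a i \<omega>) = a i \<omega> * indicator {..q} (u i \<omega>)" if "\<omega> \<in> space M" for i \<omega>
      using u_eq[OF that] by simp
    have "a i \<omega> * indicator {..q} (u i \<omega>) \<in> {0..1}" if "\<omega> \<in> space M" for i \<omega>
      using a_01[OF that, of i] by (auto simp: indicator_def)
    then have "AE \<omega> in M. (\<lambda>n. (\<Sum>i<n. ?\<phi> (x i \<omega>, y i \<omega>, a i \<omega>)) / real n)
        \<longlonglongrightarrow> expectation (\<lambda>\<omega>. ?\<phi> (x 0 \<omega>, y 0 \<omega>, a 0 \<omega>))"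
      by (intro average_tendsto[OF \<phi>]) (simp only: eq)
    also have "expectation (\<lambda>\<omega>. ?\<phi> (x 0 \<omega>, y 0 \<omega>, a 0 \<omega>)) =
        expectation (\<lambda>\<omega>. a 0 \<omega> * indicator {..q} (u 0 \<omega>))"
      by (intro Bochner_Integration.integral_cong refl eq)
    finally show "AE \<omega> in M. (\<lambda>n. (\<Sum>i<n. a i \<omega> * indicator {..q} (u i \<omega>)) / real n)
        \<longlonglongrightarrow> ?\<eta> * cdf (distr M borel (u 0)) q"
      using AE_space by eventually_elim (simp only: eq expectation_a_u)
  qed
  have r_average: "AE \<omega> in M. \<forall>q\<in>\<rat>. (\<lambda>n. (\<Sum>i<n. indicator {..q} (?r i \<omega>)) / real n)
      \<longlonglongrightarrow> cdf (distr M borel (?r 0)) q"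
  proof (rule AE_ball_countable'[OF _ countable_rat])
    fix q :: real
    let ?\<phi> = "\<lambda>z :: (real ^ 'p) \<times> real \<times> real. indicator {..q} (g (fst z) \<beta>\<^sub>0) :: real"
    have "?\<phi> \<in> borel \<Otimes>\<^sub>M borel \<Otimes>\<^sub>M borel \<rightarrow>\<^sub>M borel" by measurable
    from average_tendsto[OF this]
    have "AE \<omega> in M. (\<lambda>n. (\<Sum>i<n. indicator {..q} (?r i \<omega>)) / real n)
        \<longlonglongrightarrow> expectation (\<lambda>\<omega>. indicator {..q} (?r 0 \<omega>))"
      by (simp add: indicator_def)
    also have "expectation (\<lambda>\<omega>. indicator {..q} (?r 0 \<omega>)) =
        expectation (indicator (?r 0 -` {..q} \<inter> space M))"
      by (intro Bochner_Integration.integral_cong) (auto simp: indicator_def)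
    also have "\<dots> = cdf (distr M borel (?r 0)) q" by (simp add: cdf_def measure_distr)
    finally show "AE \<omega> in M. (\<lambda>n. (\<Sum>i<n. indicator {..q} (?r i \<omega>)) / real n)
        \<longlonglongrightarrow> cdf (distr M borel (?r 0)) q" .
  qed
  show ?thesis
    using perturbation_average_tendsto_0[OF assms] a_average u_average r_average AE_space
  proof eventually_elim
    case (elim \<omega>)
    let ?A = "\<lambda>n. observed_idx a n \<omega>"
    let ?d = "\<lambda>n i. min 1 \<bar>g (x i \<omega>) (\<beta>hat n \<omega>) - ?r i \<omega>\<bar>"
    note \<omega> = \<open>\<omega> \<in> space M\<close>
    have card_A: "real (card (?A n)) = (\<Sum>i<n. a i \<omega>)" for n
      using sum_observed_idx[OF \<omega>, of "\<lambda>_. 1" n] by simp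
    \<comment> \<open>Averages over the observed cases are ratios of averages over all cases.\<close>
    have observed_average: "(\<lambda>n. (\<Sum>i\<in>?A n. f n i) / card (?A n)) \<longlonglongrightarrow> c / ?\<eta>"
      if "(\<lambda>n. (\<Sum>i<n. a i \<omega> * f n i) / real n) \<longlonglongrightarrow> c" for f c
    proof -
      have "(\<lambda>n. ((\<Sum>i<n. a i \<omega> * f n i) / real n) / ((\<Sum>i<n. a i \<omega>) / real n)) \<longlonglongrightarrow> c / ?\<eta>"
        using eta_pos elim by (intro tendsto_divide that) auto
      moreover have "\<forall>\<^sub>F n in sequentially.
          ((\<Sum>i<n. a i \<omega> * f n i) / real n) / ((\<Sum>i<n. a i \<omega>) / real n) =
          (\<Sum>i\<in>?A n. f n i) / card (?A n)"
        using eventually_gt_at_top[of 0]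
        by eventually_elim (simp add: card_A sum_observed_idx[OF \<omega>])
      ultimately show ?thesis by (rule Lim_transform_eventually)
    qed
    have "\<forall>\<^sub>F n in sequentially. (\<Sum>i<n. a i \<omega>) / real n > 0"
      using elim eta_pos by (intro order_tendstoD(1)) auto
    then have A_ne: "\<forall>\<^sub>F n in sequentially. ?A n \<noteq> {}"
    proof eventually_elim
      case (elim n)
      then show ?case using card_A[of n] by auto
    qed
    have n_ne: "\<forall>\<^sub>F n in sequentially. {..<n} \<noteq> {}"
      using eventually_gt_at_top[of "0::nat"] by eventually_elim auto
    have "\<forall>\<^sub>F n in sequentially. real_distribution (Fhat g x y a \<beta>hat n \<omega>)"
      using A_ne n_ne by eventually_elim (auto simp: Fhat_def simp flip: empirical_def
          intro!: real_distribution_empirical)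
    moreover have "(\<lambda>n. char (Fhat g x y a \<beta>hat n \<omega>) t) \<longlonglongrightarrow> char (distr M borel (y 0)) t" for t
      unfolding char_Fhat char_y
    proof (rule tendsto_mult)
      show "(\<lambda>n. char (empirical {..<n} (\<lambda>j. g (x j \<omega>) (\<beta>hat n \<omega>))) t)
          \<longlonglongrightarrow> char (distr M borel (?r 0)) t"
        using elim n_ne by (intro char_empirical_tendsto[where f = "\<lambda>j. ?r j \<omega>"]
            real_distribution_distr) auto
      have "(\<lambda>n. (\<Sum>i<n. a i \<omega> * ?d n i) / real n) \<longlonglongrightarrow> 0"
      proof (rule Lim_null_comparison)
        have "norm ((\<Sum>i<n. a i \<omega> * ?d n i) / real n) \<le> (\<Sum>i<n. ?d n i) / real n" for n
        proof -
          have "norm (\<Sum>i<n. a i \<omega> * ?d n i) \<le> (\<Sum>i<n. ?d n i)"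
          proof (rule sum_norm_le)
            fix i
            have "a i \<omega> = 0 \<or> a i \<omega> = 1" using a_01[OF \<omega>, of i] by auto
            then show "norm (a i \<omega> * ?d n i) \<le> ?d n i" by auto
          qed
          then show ?thesis by (simp add: divide_right_mono)
        qed
        then show "\<forall>\<^sub>F n in sequentially. norm ((\<Sum>i<n. a i \<omega> * ?d n i) / real n)
            \<le> (\<Sum>i<n. ?d n i) / real n" by simp
      qed (use elim in simp)
      from observed_average[OF this]
      have close: "(\<lambda>n. (\<Sum>i\<in>?A n. min 1 \<bar>uhat g x y \<beta>hat n \<omega> i - u i \<omega>\<bar>) / card (?A n)) \<longlonglongrightarrow> 0"
        by (simp add: uhat_def u_eq[OF \<omega>] abs_minus_commute)
      have "(\<lambda>n. (\<Sum>i\<in>?A n. indicator {..q} (u i \<omega>)) / card (?A n))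
          \<longlonglongrightarrow> cdf (distr M borel (u 0)) q" if "q \<in> \<rat>" for q
        using observed_average[of "\<lambda>_ i. indicator {..q} (u i \<omega>)"] elim that eta_pos by fastforce
      with close A_ne
      show "(\<lambda>n. char (empirical (?A n) (uhat g x y \<beta>hat n \<omega>)) t)
          \<longlonglongrightarrow> char (distr M borel (u 0)) t"
        by (intro char_empirical_tendsto[where f = "\<lambda>i. u i \<omega>"] real_distribution_distr) auto
    qed
    ultimately show ?case by simp
  qed
qed

end

section \<open>Consistency of the estimated distribution and location\<close>

theorem theorem1:
  fixes M :: "'w measure"
    and x :: "nat \<Rightarrow> 'w \<Rightarrow> real ^ 'p"
    and y a u :: "nat \<Rightarrow> 'w \<Rightarrow> real"
    and g :: "real ^ 'p \<Rightarrow> real ^ 'q \<Rightarrow> real"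
    and gdot :: "real ^ 'p \<Rightarrow> real ^ 'q \<Rightarrow> real ^ 'q"
    and gddot :: "real ^ 'p \<Rightarrow> real ^ 'q \<Rightarrow> real ^ 'q ^ 'q"
    and B :: "(real ^ 'q) set"
    and \<beta>\<^sub>0 :: "real ^ 'q"
    and \<beta>hat :: "nat \<Rightarrow> 'w \<Rightarrow> real ^ 'q"
  assumes "missing_data_model M x y a u g gdot gddot B \<beta>\<^sub>0"
    and "observed_data_estimator M x y a B \<beta>hat"
    and "AE \<omega> in M. (\<lambda>n. \<beta>hat n \<omega>) \<longlonglongrightarrow> \<beta>\<^sub>0"
  shows "(AE \<omega> in M. weak_conv_m (\<lambda>n. Fhat g x y a \<beta>hat n \<omega>) (distr M borel (y 0))) \<and>
    (\<forall>\<D> T\<^sub>L. location_functional \<D> T\<^sub>L \<and>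
        distr M borel (y 0) \<in> \<D> \<and>
        (AE \<omega> in M. \<forall>\<^sub>F n in sequentially. Fhat g x y a \<beta>hat n \<omega> \<in> \<D>) \<and>
        weakly_continuous_at \<D> T\<^sub>L (distr M borel (y 0)) \<longrightarrow>
      (AE \<omega> in M. (\<lambda>n. T\<^sub>L (Fhat g x y a \<beta>hat n \<omega>)) \<longlonglongrightarrow> T\<^sub>L (distr M borel (y 0))))"
proof -
  interpret missing_data_model M x y a u g gdot gddot B \<beta>\<^sub>0 by fact
  have "\<forall>n. \<forall>\<omega>\<in>space M. \<beta>hat n \<omega> \<in> B"
    using assms(2) by (simp add: observed_data_estimator_def)
  from char_Fhat_tendsto[OF this assms(3)]
  have weak: "AE \<omega> in M. weak_conv_m (\<lambda>n. Fhat g x y a \<beta>hat n \<omega>) (distr M borel (y 0))"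
    by eventually_elim (auto intro!: levy_continuity_eventually real_distribution_distr)
  moreover have "AE \<omega> in M. (\<lambda>n. T (Fhat g x y a \<beta>hat n \<omega>)) \<longlonglongrightarrow> T (distr M borel (y 0))"
    if "distr M borel (y 0) \<in> \<D>" "weakly_continuous_at \<D> T (distr M borel (y 0))"
      "AE \<omega> in M. \<forall>\<^sub>F n in sequentially. Fhat g x y a \<beta>hat n \<omega> \<in> \<D>" for \<D> T
    using weak that(3) by eventually_elim (rule weakly_continuous_at_eventually[OF that(2,1)])
  ultimately show ?thesis by blast
qed

end
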